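(* Let $q = p^t$ be a power of a prime $p$ and let $V$ be an $n$-dimensional vector space over the finite field $\mathbb{F}_q$. Let $r, s$ be integers with $0 \leq s < r \leq n/2$. Let $\mathcal{F}$ be a family of $r$-dimensional subspaces of $V$, let $\mathcal{F}^c$ be the complement of $\mathcal{F}$ in the set of all $r$-dimensional subspaces of $V$, and let $K$ be a field with $\operatorname{char}(K) \neq p$. If $|\mathcal{F}^c| \leq \frac{n}{r} - 1$, then $\operatorname{rank}_K(W_{r,s}^{\mathcal{F}}(q)) = \operatorname{rank}_K(W_{r,s}(q))$.
   Context: For a family (set) $\mathcal{F}$ of $r$-dimensional subspaces of $V$, the higher inclusion matrix $W_{r,s}^{\mathcal{F}}(q)$ of $r$-subspaces vs. $s$-subspaces is the $(0,1)$-matrix with rows indexed by the $r$-dimensional subspaces $R \in \mathcal{F}$, columns indexed by all $s$-dimensional subspaces $S$ of $V$, and $(R,S)$-entry equal to $1$ if and only if $S \subseteq R$. When $\mathcal{F}$ consists of all $r$-dimensional subspaces of $V$, one writes $W_{r,s}(q)$ for $W_{r,s}^{\mathcal{F}}(q)$. The notation $\operatorname{rank}_K$ means the rank of the matrix with its entries $0,1$ regarded as elements of $K$. *)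

theory Defs
  imports "Jordan_Normal_Form.DL_Rank" "HOL-Computational_Algebra.Primes"
begin

definition subspaces_of_dim ::
    "('f::field \<Rightarrow> 'v::ab_group_add \<Rightarrow> 'v) \<Rightarrow> nat \<Rightarrow> 'v set set" where
  "subspaces_of_dim scale k =
     {U. module.subspace scale U \<and> vector_space.dim scale U = k}"

(* AFP matrices are indexed by initial segments of the naturals, so the rows and columns are
   enumerated by lists; the entries 0 and 1 are those of the coefficient field. *)
definition inclusion_mat :: "'v set list \<Rightarrow> 'v set list \<Rightarrow> 'k::field mat" where
  "inclusion_mat Rs Ss =
     mat (length Rs) (length Ss) (\<lambda>(i, j). if Ss ! j \<subseteq> Rs ! i then 1 else 0)"

(* A matrix indexed by sets of subspaces is determined only up to the order of its rows and
   columns: the predicate holds for exactly the matrices obtained from some ordering. *)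
definition is_higher_inclusion_mat ::
    "('f::field \<Rightarrow> 'v::ab_group_add \<Rightarrow> 'v) \<Rightarrow> 'v set set \<Rightarrow> nat \<Rightarrow> 'k::field mat \<Rightarrow> bool" where
  "is_higher_inclusion_mat scale F s W \<longleftrightarrow>
     (\<exists>Rs Ss. distinct Rs \<and> set Rs = F \<and>
              distinct Ss \<and> set Ss = subspaces_of_dim scale s \<and>
              W = inclusion_mat Rs Ss)"

(* vec_space.rank n is the dimension of the column span inside K^n, so n must be the number
   of rows. *)
definition mat_rank :: "'k::field mat \<Rightarrow> nat" where
  "mat_rank A = vec_space.rank (dim_row A) A"

lemma is_higher_inclusion_mat_exists:
  fixes scale :: "'f::field \<Rightarrow> 'v::ab_group_add \<Rightarrow> 'v"
  assumes "finite (UNIV :: 'v set)"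
  shows "\<exists>W :: 'k::field mat. is_higher_inclusion_mat scale F s W"
proof -
  have fin: "finite A" for A :: "'v set set"
    using assms by (metis Finite_Set.finite_set finite_subset subset_UNIV)
  obtain Rs where "distinct Rs" "set Rs = F"
    using finite_distinct_list[OF fin] by blast
  moreover obtain Ss where "distinct Ss" "set Ss = subspaces_of_dim scale s"
    using finite_distinct_list[OF fin] by blast
  ultimately show ?thesis
    unfolding is_higher_inclusion_mat_def by blast
qed

end

theory Submission
  imports Defs "Jordan_Normal_Form.Matrix_Kernel"
begin

text \<open>
  Deleting rows from a matrix preserves its rank as soon as every deleted row is a linear
  combination of the remaining ones. In dual form: a function \<open>x\<close> on the \<open>s\<close>-subspaces whose sums
  over the \<open>s\<close>-subspaces of each member of \<open>F\<close> vanish must have vanishing sum below every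
  \<open>r\<close>-subspace. This makes the two matrices have the same kernel, and rank-nullity
  (\<open>rank_plus_nullity\<close>) turns equal kernels into equal ranks.

  So fix a missing \<open>r\<close>-subspace \<open>R\<close>. The span \<open>Y\<close> of all missing subspaces has dimension at most
  \<open>card M * r\<close>, where \<open>M\<close> is the set of missing subspaces, and the bound on \<open>card M\<close> says exactly
  that this leaves room for an \<open>r\<close>-dimensional subspace \<open>U\<close> with \<open>U \<inter> Y = {0}\<close>
  (\<open>coordinates_adapted_to_missing_subspaces\<close>). The graphs \<open>{v + A v | v. v \<in> R}\<close> of the linear maps
  \<open>A : R \<rightarrow> U\<close> are \<open>r\<close>-subspaces. The graph of \<open>0\<close> is \<open>R\<close>, and every other graph leaves \<open>Y\<close>
  (\<open>matrix_eq_zero_if_graph_subset\<close>) and hence belongs to \<open>F\<close>.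

  Identify \<open>U\<close> with \<open>R\<close>, so that \<open>A\<close> has a trace, and give \<open>A\<close> the weight \<open>1\<close> if its trace is \<open>0\<close>,
  the weight \<open>-1\<close> if its trace is \<open>1\<close>, and the weight \<open>0\<close> otherwise. For every subspace \<open>S\<close> of
  dimension less than \<open>r\<close> the weights of the graphs above \<open>S\<close> add up to \<open>0\<close>
  (\<open>weighted_graphs_cancel\<close>): the projection of \<open>S\<close> to \<open>R\<close> is proper, so there is a map \<open>N\<close> of trace
  \<open>1\<close> vanishing on it, and \<open>A \<mapsto> A + N\<close> matches the maps of trace \<open>0\<close> whose graphs contain \<open>S\<close> with
  those of trace \<open>1\<close>. Thus the weighted rows of the graphs add up to \<open>0\<close>, and since \<open>R\<close> occurs with
  coefficient \<open>1\<close>, its row is a combination of rows of members of \<open>F\<close>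
  (\<open>missing_row_in_row_space\<close>).
\<close>

section \<open>Ranks and kernels of inclusion matrices\<close>

lemma rank_plus_nullity:
  fixes A :: "'k::field mat"
  assumes A: "A \<in> carrier_mat nr nc"
  shows "mat_rank A + vectorspace.dim class_ring
           ((module_vec TYPE('k) nc)\<lparr>carrier := mat_kernel A\<rparr>) = nc"
proof -
  interpret V: vec_space "TYPE('k)" nc .
  interpret W: vec_space "TYPE('k)" nr .
  let ?T = "\<lambda>v. A *\<^sub>v v"
  interpret L: linear_map class_ring "module_vec TYPE('k) nc" "module_vec TYPE('k) nr" ?T
  proof (intro linear_map.intro mod_hom.intro mod_hom_axioms.intro)
    show "?T \<in> LinearCombinations.module_hom class_ring (module_vec TYPE('k) nc) (module_vec TYPE('k) nr)"
      using A by (auto simp: LinearCombinations.module_hom_def module_vec_simps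
          mult_add_distrib_mat_vec mult_mat_vec)
  qed (unfold_locales)
  have "L.imT = W.col_space A"
    using A by (auto simp: L.im_def W.col_space_eq[OF A] module_vec_simps image_def)
  moreover have "L.kerT = mat_kernel A"
    using A by (auto simp: L.ker_def mat_kernel[OF A] module_vec_simps)
  ultimately show ?thesis
    using L.rank_nullity[OF V.fin_dim] A
    by (simp add: mat_rank_def W.rank_def W.col_space_def V.dim_is_n)
qed

lemma mat_rank_eq_if_kernels_eq:
  fixes A B :: "'k::field mat"
  assumes "dim_col A = dim_col B" and "mat_kernel A = mat_kernel B"
  shows "mat_rank A = mat_rank B"
  using rank_plus_nullity[of A "dim_row A" "dim_col A"]
    rank_plus_nullity[of B "dim_row B" "dim_col B"] assms
  by (metis add_right_cancel carrier_mat_triv)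

lemma mat_rank_eq_if_cols_eq:
  assumes "dim_row A = dim_row B" and "set (cols A) = set (cols B)"
  shows "mat_rank A = mat_rank B"
  using assms by (simp add: mat_rank_def vec_space.rank_def)

text \<open>The rank depends only on the set of columns, so two enumerations of the same columns can be
  interchanged. The rows do not allow this argument; they are compared through kernels below.\<close>

lemma inclusion_mat_column_order:
  assumes "set Ss = set Ss'"
  shows "mat_rank (inclusion_mat Rs Ss :: 'k::field mat) = mat_rank (inclusion_mat Rs Ss' :: 'k mat)"
proof (rule mat_rank_eq_if_cols_eq)
  have "cols (inclusion_mat Rs Us :: 'k mat) =
        map (\<lambda>S. vec (length Rs) (\<lambda>i. if S \<subseteq> Rs ! i then 1 else 0)) Us" for Us
    by (rule nth_equalityI) (auto simp: inclusion_mat_def)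
  then show "set (cols (inclusion_mat Rs Ss :: 'k mat)) = set (cols (inclusion_mat Rs Ss' :: 'k mat))"
    by (simp add: assms)
qed (simp add: inclusion_mat_def)

lemma eq_vec_zero_iff:
  "dim_vec u = n \<Longrightarrow> u = 0\<^sub>v n \<longleftrightarrow> (\<forall>i<n. u $ i = 0)"
  by (metis eq_vecI index_zero_vec)

text \<open>Indexing the entries of a vector by subspaces rather than by positions makes membership in
  the kernel a condition on the set of rows alone.\<close>

lemma inclusion_mat_kernel_iff:
  fixes x :: "'v set \<Rightarrow> 'k::field"
  assumes "distinct Ss"
  shows "vec (length Ss) (\<lambda>j. x (Ss ! j)) \<in> mat_kernel (inclusion_mat Rs Ss) \<longleftrightarrow>
    (\<forall>R\<in>set Rs. (\<Sum>S\<in>set Ss. x S * of_bool (S \<subseteq> R)) = 0)"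
proof -
  let ?v = "vec (length Ss) (\<lambda>j. x (Ss ! j))"
  have entry: "(inclusion_mat Rs Ss *\<^sub>v ?v) $ i = (\<Sum>S\<in>set Ss. x S * of_bool (S \<subseteq> Rs ! i))"
    if "i < length Rs" for i
  proof -
    have "(inclusion_mat Rs Ss *\<^sub>v ?v) $ i =
        (\<Sum>k<length Ss. inclusion_mat Rs Ss $$ (i, k) * ?v $ k)"
      using that by (simp add: inclusion_mat_def scalar_prod_def lessThan_atLeast0)
    also have "\<dots> = (\<Sum>k<length Ss. x (Ss ! k) * of_bool (Ss ! k \<subseteq> Rs ! i))"
      by (rule sum.cong) (simp_all add: inclusion_mat_def that)
    also have "\<dots> = (\<Sum>S\<in>set Ss. x S * of_bool (S \<subseteq> Rs ! i))"
      by (rule sum.reindex_bij_betw[OF bij_betw_nth[OF assms refl refl]])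
    finally show ?thesis .
  qed
  have "inclusion_mat Rs Ss *\<^sub>v ?v = 0\<^sub>v (length Rs) \<longleftrightarrow>
        (\<forall>i<length Rs. (inclusion_mat Rs Ss *\<^sub>v ?v) $ i = 0)"
    by (rule eq_vec_zero_iff) (simp add: inclusion_mat_def)
  also have "\<dots> \<longleftrightarrow> (\<forall>R\<in>set Rs. (\<Sum>S\<in>set Ss. x S * of_bool (S \<subseteq> R)) = 0)"
    unfolding all_set_conv_all_nth by (simp only: entry cong: imp_cong)
  finally show ?thesis
    by (simp add: mat_kernel_def inclusion_mat_def)
qed

lemma vec_indexed_by_distinct_list:
  assumes "distinct Ss" and "v \<in> carrier_vec (length Ss)"
  obtains x where "v = vec (length Ss) (\<lambda>j. x (Ss ! j))"
proof
  have "inj_on ((!) Ss) {..<length Ss}"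
    using assms(1) by (simp add: inj_on_nth)
  then show "v = vec (length Ss) (\<lambda>j. (\<lambda>S. v $ inv_into {..<length Ss} ((!) Ss) S) (Ss ! j))"
    using assms(2) by (intro eq_vecI) simp_all
qed

lemma mat_rank_inclusion_mat_eq:
  assumes "distinct Ss"
    and "\<And>x :: 'v set \<Rightarrow> 'k::field.
      (\<forall>R\<in>set Rs. (\<Sum>S\<in>set Ss. x S * of_bool (S \<subseteq> R)) = 0) \<longleftrightarrow>
      (\<forall>R\<in>set Rs'. (\<Sum>S\<in>set Ss. x S * of_bool (S \<subseteq> R)) = 0)"
  shows "mat_rank (inclusion_mat Rs Ss :: 'k mat) = mat_rank (inclusion_mat Rs' Ss :: 'k mat)"
proof (rule mat_rank_eq_if_kernels_eq)
  have "v \<in> mat_kernel (inclusion_mat Rs Ss) \<longleftrightarrow> v \<in> mat_kernel (inclusion_mat Rs' Ss)"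
    if v: "v \<in> carrier_vec (length Ss)" for v :: "'k vec"
  proof -
    obtain x where "v = vec (length Ss) (\<lambda>j. x (Ss ! j))"
      using vec_indexed_by_distinct_list[OF assms(1) v] .
    then show ?thesis
      by (simp only: inclusion_mat_kernel_iff[OF assms(1)] assms(2))
  qed
  moreover have "mat_kernel (inclusion_mat Us Ss :: 'k mat) \<subseteq> carrier_vec (length Ss)" for Us
    by (rule mat_kernel_carrier[of _ "length Us"]) (simp add: inclusion_mat_def)
  ultimately show "mat_kernel (inclusion_mat Rs Ss :: 'k mat) = mat_kernel (inclusion_mat Rs' Ss)"
    by blast
next
  show "dim_col (inclusion_mat Rs Ss :: 'k mat) = dim_col (inclusion_mat Rs' Ss :: 'k mat)"
    by (simp add: inclusion_mat_def)
qed

section \<open>Graphs of linear maps between two independent subspaces\<close>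

text \<open>The basis \<open>E\<close> of the whole space contains a basis \<open>B\<close> of a subspace \<open>R\<close> and a disjoint copy
  \<open>\<theta> ` B\<close> of \<open>B\<close>, which spans the subspace \<open>U\<close>. The bijection \<open>\<theta>\<close> identifies \<open>R\<close> with \<open>U\<close> and is
  what gives a linear map from \<open>R\<close> to \<open>U\<close> a trace.\<close>

locale coordinates_with_twin = vector_space scale
  for scale :: "'f::{field, finite} \<Rightarrow> 'v::ab_group_add \<Rightarrow> 'v" (infixr \<open>*s\<close> 75) +
  fixes E B :: "'v set" and \<theta> :: "'v \<Rightarrow> 'v"
  assumes finite_E: "finite E" and independent_E: "independent E" and span_E: "span E = UNIV"
    and B_subset: "B \<subseteq> E" and twin_subset: "\<theta> ` B \<subseteq> E - B" and inj_twin: "inj_on \<theta> B"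
begin

abbreviation coord :: "'v \<Rightarrow> 'v \<Rightarrow> 'f" where
  "coord v e \<equiv> representation E v e"

lemma finite_B: "finite B"
  using finite_subset[OF B_subset finite_E] .

lemma linear_coord: "Vector_Spaces.linear scale (*) (\<lambda>v. coord v e)"
  by (rule linear_representation[OF independent_E span_E])

lemma coord_zero: "coord 0 e = 0"
proof -
  interpret coord: Vector_Spaces.linear scale "(*)" "\<lambda>v. coord v e" by (rule linear_coord)
  show ?thesis by (rule coord.zero)
qed

lemma coord_add: "coord (v + w) e = coord v e + coord w e"
proof -
  interpret coord: Vector_Spaces.linear scale "(*)" "\<lambda>v. coord v e" by (rule linear_coord)
  show ?thesis by (rule coord.add)
qed

lemma coord_scale: "coord (c *s v) e = c * coord v e"
proof -
  interpret coord: Vector_Spaces.linear scale "(*)" "\<lambda>v. coord v e" by (rule linear_coord)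
  show ?thesis by (rule coord.scale)
qed

lemma coord_sum: "coord (\<Sum>i\<in>I. f i) e = (\<Sum>i\<in>I. coord (f i) e)"
proof -
  interpret coord: Vector_Spaces.linear scale "(*)" "\<lambda>v. coord v e" by (rule linear_coord)
  show ?thesis by (rule coord.sum)
qed

lemma coord_basis: "b \<in> E \<Longrightarrow> coord b e = of_bool (e = b)"
  by (simp add: representation_basis[OF independent_E])

lemma sum_coord: "(\<Sum>e\<in>E. coord v e *s e) = v"
  by (rule sum_representation_eq[OF independent_E _ finite_E]) (auto simp: span_E)

lemma eq_if_coord_eq:
  assumes "\<And>e. e \<in> E \<Longrightarrow> coord v e = coord w e" shows "v = w"
proof -
  have "(\<Sum>e\<in>E. coord v e *s e) = (\<Sum>e\<in>E. coord w e *s e)"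
    by (rule sum.cong) (simp_all only: assms)
  then show ?thesis by (simp only: sum_coord)
qed

lemma coord_lincomb:
  assumes "A \<subseteq> E" "e \<in> E"
  shows "coord (\<Sum>b\<in>A. w b *s b) e = (if e \<in> A then w e else 0)"
proof -
  have "coord (\<Sum>b\<in>A. w b *s b) e = (\<Sum>b\<in>A. if b = e then w b else 0)"
    using assms by (auto simp: coord_sum coord_scale coord_basis subset_iff intro!: sum.cong)
  also have "\<dots> = (if e \<in> A then w e else 0)"
    using finite_subset[OF assms(1) finite_E] by simp
  finally show ?thesis .
qed

lemma mem_span_iff_coord:
  assumes "A \<subseteq> E" shows "v \<in> span A \<longleftrightarrow> (\<forall>e\<in>E - A. coord v e = 0)"
proof
  assume "v \<in> span A"
  then show "\<forall>e\<in>E - A. coord v e = 0"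
  proof (induction rule: span_induct_alt)
    case base then show ?case by (simp add: coord_zero)
  next
    case (step c x y)
    then show ?case using assms by (auto simp: coord_add coord_scale coord_basis subset_iff)
  qed
next
  assume *: "\<forall>e\<in>E - A. coord v e = 0"
  have "v = (\<Sum>e\<in>A. coord v e *s e)"
    using sum.mono_neutral_left[OF finite_E assms, of "\<lambda>e. coord v e *s e"] * sum_coord[of v] by simp
  also have "\<dots> \<in> span A"
    by (intro span_sum span_scale span_base)
  finally show "v \<in> span A" .
qed

text \<open>The graph over \<open>span B\<close> of the linear map sending \<open>b\<close> to \<open>\<Sum>c\<in>B. a (b, c) *s \<theta> c\<close>, written as a
  system of equations in coordinates. In this form it is visible that replacing \<open>a\<close> by another
  matrix affects the membership of \<open>v\<close> only through the sums \<open>\<Sum>b\<in>B. coord v b * a (b, c)\<close>.\<close>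

definition graph :: "('v \<times> 'v \<Rightarrow> 'f) \<Rightarrow> 'v set" where
  "graph a = {v. (\<forall>e\<in>E - B - \<theta> ` B. coord v e = 0) \<and>
                 (\<forall>c\<in>B. coord v (\<theta> c) = (\<Sum>b\<in>B. coord v b * a (b, c)))}"

lemma subspace_graph: "subspace (graph a)"
proof (rule subspaceI)
  show "0 \<in> graph a" by (simp add: graph_def coord_zero)
  show "v + w \<in> graph a" if "v \<in> graph a" "w \<in> graph a" for v w
    using that by (simp add: graph_def coord_add distrib_right sum.distrib)
  show "k *s v \<in> graph a" if "v \<in> graph a" for k v
    using that by (simp add: graph_def coord_scale sum_distrib_left mult.assoc)
qed

lemma graph_zero: "graph (\<lambda>_. 0) = span B"
proof (intro equalityI subsetI)
  fix v assume "v \<in> graph (\<lambda>_. 0)"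
  then have "coord v e = 0" if "e \<in> E - B" for e
    using that by (cases "e \<in> \<theta> ` B") (auto simp: graph_def)
  then show "v \<in> span B" by (simp add: mem_span_iff_coord[OF B_subset])
next
  fix v assume "v \<in> span B"
  then have "coord v e = 0" if "e \<in> E - B" for e
    using that by (simp add: mem_span_iff_coord[OF B_subset])
  then show "v \<in> graph (\<lambda>_. 0)"
    using twin_subset by (simp add: graph_def image_subset_iff)
qed

text \<open>The graph is the image of \<open>span B\<close> under \<open>L = id + A\<close>, and \<open>L\<close> is injective there because it
  does not change the coordinates in \<open>B\<close>.\<close>

lemma dim_graph: "dim (graph a) = card B"
proof -
  interpret finite_dimensional_vector_space scale E
    by unfold_locales (auto simp: finite_E independent_E span_E)
  interpret pair: finite_dimensional_vector_space_pair_1 scale E scale ..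
  define L where "L x = x + (\<Sum>c\<in>B. (\<Sum>b\<in>B. coord x b * a (b, c)) *s \<theta> c)" for x
  have lin: "Vector_Spaces.linear scale scale L"
    unfolding Vector_Spaces.linear_iff L_def
    by (auto simp: vector_space_axioms coord_add coord_scale distrib_right sum.distrib scale_left_distrib
       scale_right_distrib scale_sum_right sum_distrib_left mult.assoc)
  have L_other: "coord (L x) e = coord x e" if "e \<in> E - \<theta> ` B" for x e
  proof -
    have "coord (\<theta> c) e = 0" if "c \<in> B" for c
      using that \<open>e \<in> E - \<theta> ` B\<close> twin_subset by (subst coord_basis) auto
    then show ?thesis by (simp add: L_def coord_add coord_sum coord_scale)
  qed
  have L_twin: "coord (L x) (\<theta> c) = coord x (\<theta> c) + (\<Sum>b\<in>B. coord x b * a (b, c))"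
    if c: "c \<in> B" for x c
  proof -
    have "coord (\<Sum>d\<in>B. (\<Sum>b\<in>B. coord x b * a (b, d)) *s \<theta> d) (\<theta> c) =
          (\<Sum>d\<in>B. if d = c then (\<Sum>b\<in>B. coord x b * a (b, d)) else 0)"
      unfolding coord_sum
      using c twin_subset inj_twin
      by (intro sum.cong) (auto simp: coord_scale coord_basis inj_on_eq_iff image_subset_iff)
    then show ?thesis using c finite_B by (simp add: L_def coord_add)
  qed
  have "graph a = L ` span B"
  proof (intro equalityI subsetI)
    fix v assume v: "v \<in> graph a"
    define x where "x = (\<Sum>b\<in>B. coord v b *s b)"
    have x: "coord x e = (if e \<in> B then coord v e else 0)" if "e \<in> E" for e
      unfolding x_def by (rule coord_lincomb[OF B_subset that])
    have "v = L x"
    proof (rule eq_if_coord_eq)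
      fix e assume e: "e \<in> E"
      show "coord v e = coord (L x) e"
      proof (cases "e \<in> \<theta> ` B")
        case True
        then obtain c where c: "c \<in> B" "e = \<theta> c" by blast
        then have "coord v e = (\<Sum>b\<in>B. coord v b * a (b, c))" using v by (simp add: graph_def)
        also have "\<dots> = (\<Sum>b\<in>B. coord x b * a (b, c))"
          using B_subset by (intro sum.cong) (auto simp: x subset_iff)
        finally show ?thesis using L_twin[OF c(1), of x] c x[OF e] twin_subset e by auto
      next
        case False
        then show ?thesis using v e by (auto simp: L_other x graph_def)
      qed
    qed
    moreover have "x \<in> span B" unfolding x_def by (intro span_sum span_scale span_base)
    ultimately show "v \<in> L ` span B" by blast
  next
    fix v assume "v \<in> L ` span B"
    then obtain x where x: "x \<in> span B" and v: "v = L x" by blast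
    have x0: "coord x e = 0" if "e \<in> E - B" for e
      using x that mem_span_iff_coord[OF B_subset] by blast
    have "(\<Sum>b\<in>B. coord (L x) b * a (b, c)) = (\<Sum>b\<in>B. coord x b * a (b, c))" for c
      using B_subset twin_subset by (intro sum.cong refl arg_cong2[of _ _ _ _ "(*)"] L_other) auto
    then show "v \<in> graph a"
      using twin_subset by (auto simp: v graph_def L_other x0 L_twin image_subset_iff)
  qed
  moreover have "inj_on L (span (span B))"
  proof (rule inj_onI)
    fix x y assume "x \<in> span (span B)" "y \<in> span (span B)" and eq: "L x = L y"
    then have "coord x e = coord y e" if "e \<in> E - B" for e
      using that by (simp add: span_span mem_span_iff_coord[OF B_subset])
    moreover have "coord x e = coord y e" if "e \<in> B" for e
    proof -
      have "e \<in> E - \<theta> ` B" using that B_subset twin_subset by auto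
      then show ?thesis using eq L_other[of e x] L_other[of e y] by simp
    qed
    ultimately show "x = y" by (intro eq_if_coord_eq) blast
  qed
  ultimately have "dim (graph a) = dim (span B)"
    using pair.dim_image_eq[OF lin] by simp
  then show ?thesis
    using dim_span_eq_card_independent[OF independent_mono[OF independent_E B_subset]] by simp
qed

text \<open>Matrices vanish outside \<open>B \<times> B\<close>, so that each linear map is represented exactly once and there
  are finitely many of them.\<close>

definition square_matrices :: "('v \<times> 'v \<Rightarrow> 'f) set" where
  "square_matrices = {a. \<forall>x. x \<notin> B \<times> B \<longrightarrow> a x = 0}"

lemma finite_square_matrices: "finite square_matrices"
proof -
  have "square_matrices = {a. \<forall>x. (x \<in> B \<times> B \<longrightarrow> a x \<in> UNIV) \<and> (x \<notin> B \<times> B \<longrightarrow> a x = 0)}"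
    unfolding square_matrices_def by blast
  also have "finite \<dots>"
    by (intro finite_set_of_finite_funs finite_cartesian_product finite_B finite)
  finally show ?thesis .
qed

definition trace :: "('v \<times> 'v \<Rightarrow> 'f) \<Rightarrow> 'f" where
  "trace a = (\<Sum>b\<in>B. a (b, b))"

text \<open>A graph inside \<open>span (E - \<theta> ` B)\<close> has no component in \<open>U\<close>, so it lies in \<open>span B\<close> and, by
  dimension, equals it; then each \<open>b \<in> B\<close> is mapped to \<open>0\<close>.\<close>

lemma matrix_eq_zero_if_graph_subset:
  assumes "a \<in> square_matrices" and "graph a \<subseteq> span (E - \<theta> ` B)"
  shows "a = (\<lambda>_. 0)"
proof -
  interpret finite_dimensional_vector_space scale E
    by unfold_locales (auto simp: finite_E independent_E span_E)
  have "coord v e = 0" if "v \<in> graph a" "e \<in> E - B" for v e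
    using that assms(2) mem_span_iff_coord[of "E - \<theta> ` B" v] twin_subset
    by (cases "e \<in> \<theta> ` B") (auto simp: graph_def subset_iff)
  then have "graph a \<subseteq> span B"
    by (auto simp: mem_span_iff_coord[OF B_subset])
  then have "graph a = span B"
    by (intro subspace_dim_equal subspace_graph subspace_span)
      (simp_all add: dim_graph dim_eq_card_independent independent_mono[OF independent_E B_subset])
  have "a (b, c) = 0" if "b \<in> B" "c \<in> B" for b c
  proof -
    have "b \<in> E" "\<theta> c \<noteq> b" using that B_subset twin_subset by auto
    have "b \<in> graph a" using that \<open>graph a = span B\<close> span_base by blast
    then have "coord b (\<theta> c) = (\<Sum>d\<in>B. coord b d * a (d, c))"
      using that by (simp add: graph_def)
    also have "\<dots> = (\<Sum>d\<in>B. if d = b then a (d, c) else 0)"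
      using that B_subset by (intro sum.cong) (auto simp: coord_basis)
    also have "\<dots> = a (b, c)" using that finite_B by simp
    finally show ?thesis
      using coord_basis[of b "\<theta> c"] \<open>b \<in> E\<close> \<open>\<theta> c \<noteq> b\<close> by simp
  qed
  show ?thesis
  proof
    fix x show "a x = 0"
      using \<open>\<And>b c. \<lbrakk>b \<in> B; c \<in> B\<rbrakk> \<Longrightarrow> a (b, c) = 0\<close> assms(1)
      by (cases x) (auto simp: square_matrices_def)
  qed
qed

text \<open>The projection of \<open>S\<close> to \<open>span B\<close> has dimension less than \<open>card B\<close> and hence misses some
  \<open>b0 \<in> B\<close>. A linear functional that vanishes on the projection and takes the value \<open>1\<close> at \<open>b0\<close> has
  the required values \<open>w\<close> on \<open>B\<close>.\<close>

lemma annihilating_functional: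
  assumes "dim S < card B"
  obtains b0 w where "b0 \<in> B" and "w b0 = 1" and "\<forall>v\<in>S. (\<Sum>b\<in>B. coord v b * w b) = 0"
proof -
  interpret finite_dimensional_vector_space scale E
    by unfold_locales (auto simp: finite_E independent_E span_E)
  interpret pair: finite_dimensional_vector_space_pair_1 scale E scale ..
  interpret dual: vector_space_pair scale "(*) :: 'f \<Rightarrow> 'f \<Rightarrow> 'f"
    by unfold_locales (auto simp: algebra_simps)
  define pr where "pr v = (\<Sum>b\<in>B. coord v b *s b)" for v
  have lin: "Vector_Spaces.linear scale scale pr"
    unfolding Vector_Spaces.linear_iff pr_def
    by (auto simp: vector_space_axioms coord_add coord_scale sum.distrib scale_left_distrib scale_sum_right)
  obtain C where C: "independent C" "span C = span (pr ` S)"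
    using maximal_independent_subset[of "pr ` S"] span_eq span_span span_mono
    by (metis span_minimal subspace_span subset_antisym)
  have "\<not> B \<subseteq> span C"
  proof
    assume "B \<subseteq> span C"
    then have "card B \<le> dim (span C)"
      by (rule independent_card_le_dim) (rule independent_mono[OF independent_E B_subset])
    also have "\<dots> = dim (pr ` S)" by (simp add: C(2))
    also have "\<dots> \<le> dim S" by (rule pair.dim_image_le[OF lin])
    finally show False using assms by simp
  qed
  then obtain b0 where b0: "b0 \<in> B" "b0 \<notin> span C" by blast
  then have "independent (insert b0 C)" using C(1) independent_insertI by blast
  then obtain g where g: "Vector_Spaces.linear scale (*) g" and gb: "\<forall>x\<in>insert b0 C. g x = of_bool (x = b0)"
    using dual.linear_independent_extend[of "insert b0 C" "\<lambda>x. of_bool (x = b0)"] by blast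
  interpret g: Vector_Spaces.linear scale "(*)" g by (rule g)
  have "g x = 0" if "x \<in> span C" for x
    by (rule g.eq_0_on_span[OF _ that]) (use gb b0(2) span_base in auto)
  then have "g (pr v) = 0" if "v \<in> S" for v
    using that C(2) span_base[of "pr v" "pr ` S"] by blast
  moreover have "g (pr v) = (\<Sum>b\<in>B. coord v b * g b)" for v
    by (simp only: pr_def g.sum g.scale)
  ultimately have "\<forall>v\<in>S. (\<Sum>b\<in>B. coord v b * g b) = 0"
    by simp
  then show ?thesis using gb by (intro that[of b0 g] b0(1)) simp_all
qed

section \<open>A signed combination of graphs that small subspaces cannot see\<close>

definition weight :: "('v \<times> 'v \<Rightarrow> 'f) \<Rightarrow> 'k::field" where
  "weight a = of_bool (trace a = 0) - of_bool (trace a = 1)"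

text \<open>Adding to a matrix the rank-one matrix \<open>N\<close> with \<open>w\<close> in column \<open>b0\<close> leaves unchanged whether the
  graph contains \<open>S\<close> and raises the trace by \<open>1\<close>, so it pairs the positive terms with the negative
  ones.\<close>

lemma weighted_graphs_cancel:
  assumes "dim S < card B"
  shows "(\<Sum>a\<in>square_matrices. weight a * of_bool (S \<subseteq> graph a)) = (0 :: 'k::field)"
proof -
  obtain b0 w where b0: "b0 \<in> B" "w b0 = 1"
    and w: "\<forall>v\<in>S. (\<Sum>b\<in>B. coord v b * w b) = 0"
    using annihilating_functional[OF assms] .
  define N where "N = (\<lambda>(b, c). if b \<in> B \<and> c = b0 then w b else 0)"
  have tr: "trace N = 1"
    using b0 finite_B by (simp add: trace_def N_def sum.delta' cong: sum.cong)
  have tr_add: "trace (\<lambda>x. a x + N x) = trace a + 1" "trace (\<lambda>x. a x - N x) = trace a - 1" for a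
    using tr by (simp_all add: trace_def sum.distrib sum_subtractf)
  have N: "(\<Sum>b\<in>B. coord v b * N (b, c)) = 0" if "v \<in> S" for v c
    using w that by (cases "c = b0") (simp_all add: N_def)
  have closed: "(\<lambda>x. a x + N x) \<in> square_matrices" "(\<lambda>x. a x - N x) \<in> square_matrices"
    if "a \<in> square_matrices" for a
    using that b0(1) by (auto simp: square_matrices_def N_def)
  have sub: "S \<subseteq> graph (\<lambda>x. a x + N x) \<longleftrightarrow> S \<subseteq> graph a"
            "S \<subseteq> graph (\<lambda>x. a x - N x) \<longleftrightarrow> S \<subseteq> graph a" for a
    using N by (simp_all add: graph_def subset_iff distrib_left right_diff_distrib sum.distrib
        sum_subtractf)
  have "(\<Sum>a\<in>square_matrices. of_bool (trace a = 0) * of_bool (S \<subseteq> graph a)) =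
        (\<Sum>a\<in>square_matrices. of_bool (trace a = 1) * of_bool (S \<subseteq> graph a) :: 'k)"
    by (rule sum.reindex_bij_witness[where i = "\<lambda>a x. a x - N x" and j = "\<lambda>a x. a x + N x"])
      (simp_all add: tr_add sub closed)
  then show ?thesis
    by (simp add: weight_def left_diff_distrib sum_subtractf)
qed

text \<open>Double counting: summed over all graphs with their weights, the sums of \<open>x\<close> cancel; the graph
  of the zero matrix, which has weight \<open>1\<close>, is the only one whose sum is not assumed to vanish.\<close>

lemma sum_over_span_eq_zero:
  fixes x :: "'v set \<Rightarrow> 'k::field"
  assumes T: "\<And>S. S \<in> T \<Longrightarrow> dim S < card B"
    and zero: "\<And>a. a \<in> square_matrices \<Longrightarrow> a \<noteq> (\<lambda>_. 0) \<Longrightarrow>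
      (\<Sum>S\<in>T. x S * of_bool (S \<subseteq> graph a)) = 0"
  shows "(\<Sum>S\<in>T. x S * of_bool (S \<subseteq> span B)) = 0"
proof -
  have mem: "(\<lambda>_. 0) \<in> square_matrices" by (simp add: square_matrices_def)
  have weight_0: "weight (\<lambda>_. 0) = (1 :: 'k)" by (simp add: weight_def trace_def)
  have "0 = (\<Sum>S\<in>T. x S * (\<Sum>a\<in>square_matrices. weight a * of_bool (S \<subseteq> graph a)))"
    by (rule sum.neutral[symmetric]) (simp add: weighted_graphs_cancel T)
  also have "\<dots> = (\<Sum>a\<in>square_matrices. weight a * (\<Sum>S\<in>T. x S * of_bool (S \<subseteq> graph a)))"
    unfolding sum_distrib_left by (subst sum.swap) (simp add: mult.left_commute)
  also have "\<dots> = weight (\<lambda>_. 0) * (\<Sum>S\<in>T. x S * of_bool (S \<subseteq> graph (\<lambda>_. 0)))"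
    by (subst sum.remove[OF finite_square_matrices mem]) (simp add: zero)
  finally show ?thesis by (simp add: weight_0 graph_zero)
qed

end

section \<open>Few missing subspaces leave room for a complement\<close>

lemma (in vector_space) dim_Union_le:
  \<comment> \<open>An infinite-dimensional subspace has \<open>dim\<close> equal to \<open>0\<close>; positive \<open>r\<close> makes all bases finite.\<close>
  assumes "finite M" and M: "\<And>U. U \<in> M \<Longrightarrow> dim U = r" and "0 < r"
  shows "dim (\<Union>M) \<le> card M * r"
proof -
  have "\<exists>A. finite A \<and> U \<subseteq> span A \<and> card A = r" if "U \<in> M" for U
    using basis_exists[of U] M[OF that] \<open>0 < r\<close> by (metis card.infinite less_irrefl)
  then obtain A where A: "\<And>U. U \<in> M \<Longrightarrow> finite (A U) \<and> U \<subseteq> span (A U) \<and> card (A U) = r"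
    by metis
  have "U \<subseteq> span (\<Union>U\<in>M. A U)" if "U \<in> M" for U
    using A[OF that] that span_mono[of "A U" "\<Union>U\<in>M. A U"] by blast
  then have "dim (\<Union>M) \<le> card (\<Union>U\<in>M. A U)"
    by (intro dim_le_card) (use A assms(1) in auto)
  also have "\<dots> \<le> (\<Sum>U\<in>M. card (A U))" by (rule card_UN_le[OF assms(1)])
  also have "\<dots> = card M * r" using A by simp
  finally show ?thesis .
qed

text \<open>Extend a basis \<open>B\<close> of \<open>R\<close> first to a basis \<open>C\<close> of the span of all of \<open>M\<close> and then to a basis
  \<open>E\<close> of the whole space. By the dimension bound \<open>E - C\<close> still has at least \<open>r\<close> elements, among which
  the copy \<open>\<theta> ` B\<close> can be chosen.\<close>

lemma coordinates_adapted_to_missing_subspaces: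
  fixes scale :: "'f::{field, finite} \<Rightarrow> 'v::ab_group_add \<Rightarrow> 'v"
  assumes vs: "vector_space scale" and M: "finite M" "M \<subseteq> subspaces_of_dim scale r"
    and bound: "card M * r + r \<le> vector_space.dim scale (UNIV :: 'v set)"
    and r: "0 < r" and R: "R \<in> M"
  obtains E B \<theta> where "coordinates_with_twin scale E B \<theta>" and "card B = r"
    and "module.span scale B = R" and "\<And>U. U \<in> M \<Longrightarrow> U \<subseteq> module.span scale (E - \<theta> ` B)"
proof -
  interpret vector_space scale by (rule vs)
  have sub: "subspace U" "dim U = r" if "U \<in> M" for U
    using that M(2) by (auto simp: subspaces_of_dim_def)
  obtain B where B: "B \<subseteq> R" "independent B" "R \<subseteq> span B" "card B = r"
    using basis_exists[of R] sub(2)[OF R] by metis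
  have "B \<subseteq> \<Union>M" using B(1) R by blast
  then obtain C where C: "B \<subseteq> C" "C \<subseteq> \<Union>M" "independent C" "\<Union>M \<subseteq> span C"
    using maximal_independent_subset_extend B(2) by metis
  obtain E where E: "C \<subseteq> E" "independent E" "UNIV \<subseteq> span E"
    using maximal_independent_subset_extend[OF _ C(3), of UNIV] by auto
  have card_E: "card E = dim (UNIV :: 'v set)"
    by (rule basis_card_eq_dim) (use E in auto)
  then have fin_E: "finite E" using bound r by (metis card.infinite add_is_0 le_zero_eq less_irrefl)
  have "card C \<le> card M * r"
    using basis_card_eq_dim[OF C(2,4,3)] dim_Union_le[OF M(1) sub(2) r] by simp
  then have "card B \<le> card (E - C)"
    using bound card_E B(4) card_Diff_subset[OF finite_subset[OF E(1) fin_E] E(1)] by simp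
  moreover have "finite B" using B(4) r card.infinite by fastforce
  ultimately obtain \<theta> where \<theta>: "\<theta> ` B \<subseteq> E - C" "inj_on \<theta> B"
    using card_le_inj[of B "E - C"] fin_E by auto
  show thesis
  proof
    show "coordinates_with_twin scale E B \<theta>"
      by unfold_locales (use E C(1) \<theta> fin_E in auto)
    show "span B = R" using B(1,3) sub(1)[OF R] span_minimal by blast
    have "span C \<subseteq> span (E - \<theta> ` B)" using \<theta>(1) E(1) by (intro span_mono) auto
    then show "U \<subseteq> span (E - \<theta> ` B)" if "U \<in> M" for U
      using C(4) that by blast
  qed (rule B(4))
qed

text \<open>This is the dual form of the row of \<open>R\<close> being a combination of the rows of \<open>F\<close>: whatever is
  orthogonal to the latter is orthogonal to the former.\<close>

lemma missing_row_in_row_space: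
  fixes scale :: "'f::{field, finite} \<Rightarrow> 'v::ab_group_add \<Rightarrow> 'v"
    and x :: "'v set \<Rightarrow> 'k::field"
  assumes vs: "vector_space scale" and fin: "finite (subspaces_of_dim scale r - F)"
    and bound: "card (subspaces_of_dim scale r - F) * r + r \<le> vector_space.dim scale (UNIV :: 'v set)"
    and "s < r" and R: "R \<in> subspaces_of_dim scale r - F"
    and zero: "\<And>U. U \<in> F \<Longrightarrow> (\<Sum>S\<in>subspaces_of_dim scale s. x S * of_bool (S \<subseteq> U)) = 0"
  shows "(\<Sum>S\<in>subspaces_of_dim scale s. x S * of_bool (S \<subseteq> R)) = 0"
proof -
  have "0 < r" using \<open>s < r\<close> by simp
  obtain E B \<theta> where EB: "coordinates_with_twin scale E B \<theta>" "card B = r"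
    and span_B: "module.span scale B = R"
    and missing: "\<And>U. U \<in> subspaces_of_dim scale r - F \<Longrightarrow> U \<subseteq> module.span scale (E - \<theta> ` B)"
    by (rule coordinates_adapted_to_missing_subspaces[OF vs fin Diff_subset bound \<open>0 < r\<close> R]) blast
  interpret coordinates_with_twin scale E B \<theta> by (rule EB(1))
  have "(\<Sum>S\<in>subspaces_of_dim scale s. x S * of_bool (S \<subseteq> graph a)) = 0"
    if "a \<in> square_matrices" "a \<noteq> (\<lambda>_. 0)" for a
  proof (rule zero, rule ccontr)
    assume "graph a \<notin> F"
    then have "graph a \<subseteq> span (E - \<theta> ` B)"
      by (intro missing) (simp add: subspaces_of_dim_def subspace_graph dim_graph EB(2))
    then show False using matrix_eq_zero_if_graph_subset that by blast
  qed
  then have "(\<Sum>S\<in>subspaces_of_dim scale s. x S * of_bool (S \<subseteq> span B)) = 0"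
    by (intro sum_over_span_eq_zero) (simp add: subspaces_of_dim_def EB(2) \<open>s < r\<close>)
  then show ?thesis by (simp add: span_B)
qed

section \<open>The rank of the higher inclusion matrix\<close>

theorem theorem6:
  fixes scale :: "'f::{field, finite} \<Rightarrow> 'v::ab_group_add \<Rightarrow> 'v"
    and p t q n r s :: nat
    and F :: "'v set set"
    and W_F W :: "'k::field mat"
  assumes "prime p" and "q = p ^ t" and "card (UNIV :: 'f set) = q"
    and "vector_space scale" and "vector_space.dim scale (UNIV :: 'v set) = n"
    and "s < r" and "real r \<le> real n / 2"
    and "F \<subseteq> subspaces_of_dim scale r"
    and "CHAR('k) \<noteq> p"
    and "real (card (subspaces_of_dim scale r - F)) \<le> real n / real r - 1"
    and "is_higher_inclusion_mat scale F s W_F"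
    and "is_higher_inclusion_mat scale (subspaces_of_dim scale r) s W"
  shows "mat_rank W_F = mat_rank W"
proof -
  interpret vector_space scale by (rule assms(4))
  let ?all = "subspaces_of_dim scale r"
  obtain Rs Ss where F: "set Rs = F" "distinct Ss" "set Ss = subspaces_of_dim scale s"
      "W_F = inclusion_mat Rs Ss"
    using assms(11) unfolding is_higher_inclusion_mat_def by blast
  obtain Rs' Ss' where all: "set Rs' = ?all" "set Ss' = subspaces_of_dim scale s"
      "W = inclusion_mat Rs' Ss'"
    using assms(12) unfolding is_higher_inclusion_mat_def by blast
  have "finite (?all - F)" using all(1) by (metis List.finite_set finite_Diff)
  have "real (card (?all - F) * r + r) \<le> real n"
    using assms(6,10) by (simp add: field_simps)
  then have "card (?all - F) * r + r \<le> n"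
    by (simp only: of_nat_le_iff)
  then have bound: "card (?all - F) * r + r \<le> dim UNIV"
    by (simp only: assms(5))
  have "(\<forall>R\<in>F. (\<Sum>S\<in>subspaces_of_dim scale s. x S * of_bool (S \<subseteq> R)) = 0) \<longleftrightarrow>
        (\<forall>R\<in>?all. (\<Sum>S\<in>subspaces_of_dim scale s. x S * of_bool (S \<subseteq> R)) = 0)"
    for x :: "'v set \<Rightarrow> 'k"
    using missing_row_in_row_space[OF assms(4) \<open>finite (?all - F)\<close> bound assms(6), of _ x] assms(8)
    by blast
  then have "mat_rank (inclusion_mat Rs Ss :: 'k mat) = mat_rank (inclusion_mat Rs' Ss :: 'k mat)"
    by (intro mat_rank_inclusion_mat_eq F(2)) (simp only: F(1,3) all(1))
  also have "\<dots> = mat_rank (inclusion_mat Rs' Ss' :: 'k mat)"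
    by (rule inclusion_mat_column_order) (simp only: F(3) all(2))
  finally show ?thesis by (simp only: F(4) all(3))
qed

end
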